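(* For all integers $q\ge 2$ and $n\ge q+2$, $$2^{(n/q)^{q-1}}\le N_3(q,n)\le 2^{n^{q-1}\log_2 n}.$$
   Context: For integers $k\ge 1$, $q\ge 1$, $n\ge k$, a monotone (tight) path of length $n$ in the complete $k$-uniform hypergraph on $[N]=\{1,\dots,N\}$ is given by integers $j_1<j_2<\dots<j_n$ in $[N]$ together with the $k$-element sets $\{j_i,j_{i+1},\dots,j_{i+k-1}\}$, $i=1,\dots,n-k+1$. $N_k(q,n)$ denotes the smallest integer $N$ such that for every coloring of all $k$-element subsets of $[N]$ with $q$ colors there is a monotone path of length $n$ all of whose $k$-sets receive the same color. *)

theory Defs
  imports Complex_Main "HOL-Library.Ramsey"
begin

text \<open>
  The vertices \<open>j 1 < \<dots> < j n\<close> of a monotone path in \<open>{1..N}\<close>; as usual for tight paths,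
  the length \<open>n\<close> counts vertices, and only the values of \<open>j\<close> on \<open>{1..n}\<close> matter.
\<close>

definition monotone_path :: "nat \<Rightarrow> nat \<Rightarrow> (nat \<Rightarrow> nat) \<Rightarrow> bool" where
  "monotone_path N n j \<longleftrightarrow> j ` {1..n} \<subseteq> {1..N} \<and> strict_mono_on {1..n} j"

definition path_edges :: "nat \<Rightarrow> nat \<Rightarrow> (nat \<Rightarrow> nat) \<Rightarrow> nat set set" where
  "path_edges k n j = {j ` {i..i + k - 1} | i. i \<in> {1..n - k + 1}}"

definition mono_path_arrows :: "nat \<Rightarrow> nat \<Rightarrow> nat \<Rightarrow> nat \<Rightarrow> bool" where
  "mono_path_arrows k q n N \<longleftrightarrow>
     (\<forall>c \<in> nsets {1..N} k \<rightarrow> {1..q}.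
        \<exists>j. monotone_path N n j \<and> (\<exists>a. \<forall>e \<in> path_edges k n j. c e = a))"

definition path_ramsey :: "nat \<Rightarrow> nat \<Rightarrow> nat \<Rightarrow> nat" where
  "path_ramsey k q n = (LEAST N. mono_path_arrows k q n N)"

end

theory Submission
  imports Defs
begin

text \<open>
  Upper bound: if no path is monochromatic, attach to each pair \<open>i < j\<close> the vector in
  \<open>{0..<n - 2}^q\<close> of the numbers of triples in longest paths of each colour ending in \<open>i, j\<close>.
  For \<open>i < j < k\<close> the vector of \<open>(j, k)\<close> exceeds that of \<open>(i, j)\<close> in some coordinate, so it is
  not in the down-set generated by the vectors of all \<open>(i, j)\<close>, but it is in the one belonging
  to \<open>k\<close>. Hence distinct vertices have distinct down-sets, and a down-set is determined by its
  height function \<open>{0..<n - 2}^(q - 1) \<rightarrow> {0..n - 2}\<close>.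

  Lower bound: list the subsets of an antichain in \<open>{0..<n - 2}^q\<close> as \<open>A 1, A 2, \<dots>\<close> along a linear
  extension of inclusion, choose \<open>v i j \<in> A j - A i\<close> for \<open>i < j\<close>, and colour \<open>i < j < k\<close> by a
  coordinate in which \<open>v j k\<close> exceeds \<open>v i j\<close>; it exists because \<open>v i j \<in> A j\<close> and
  \<open>v j k \<notin> A j\<close> are distinct elements of the antichain. Along a monochromatic path
  that coordinate increases, so the path has fewer than \<open>n\<close> vertices.
\<close>

section \<open>Monotonicity in the number of vertices, and edges of 3-uniform paths\<close>

lemma mono_path_arrows_mono:
  assumes "mono_path_arrows k q n M" "M \<le> N"
  shows "mono_path_arrows k q n N"
  unfolding mono_path_arrows_def
proof
  fix c assume c: "c \<in> nsets {1..N} k \<rightarrow> {1..q}"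
  have sub: "{1..M} \<subseteq> {1..N}" using assms(2) by auto
  have "c \<in> nsets {1..M} k \<rightarrow> {1..q}"
    using c nsets_mono[OF sub, of k] by blast
  then obtain j where "monotone_path M n j" "\<exists>a. \<forall>e\<in>path_edges k n j. c e = a"
    using assms(1) unfolding mono_path_arrows_def by blast
  moreover from this have "monotone_path N n j"
    using sub unfolding monotone_path_def by blast
  ultimately show "\<exists>j. monotone_path N n j \<and> (\<exists>a. \<forall>e\<in>path_edges k n j. c e = a)" by blast
qed

lemma path_edges_3:
  "path_edges 3 n j = {{j i, j (Suc i), j (Suc (Suc i))} | i. i \<in> {1..n - 3 + 1}}"
proof -
  have "{i..i + 3 - 1} = {i, Suc i, Suc (Suc i)}" for i :: nat by auto
  then show ?thesis unfolding path_edges_def by simp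
qed

section \<open>Lower bound: a colouring built from an antichain\<close>

text \<open>Induction by doubling: first list the subsets avoiding the new element \<open>x\<close>,
  then the same list with \<open>x\<close> added to each. A set of the second half contains
  \<open>x\<close>, so it lies in none of the first half.\<close>

lemma exists_subset_linear_extension:
  assumes "finite X"
  shows "\<exists>A :: nat \<Rightarrow> 'a set. (\<forall>i \<in> {1..2 ^ card X}. A i \<subseteq> X) \<and>
           (\<forall>i \<in> {1..2 ^ card X}. \<forall>j \<in> {1..2 ^ card X}. i < j \<longrightarrow> \<not> A j \<subseteq> A i)"
  using assms
proof (induction X)
  case empty
  then show ?case by (auto intro!: exI[of _ "\<lambda>_. {}"])
next
  case (insert x X)
  define M :: nat where "M = 2 ^ card X"
  obtain A where A: "(\<forall>i \<in> {1..M}. A i \<subseteq> X) \<and>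
      (\<forall>i \<in> {1..M}. \<forall>j \<in> {1..M}. i < j \<longrightarrow> \<not> A j \<subseteq> A i)"
    using insert.IH unfolding M_def by (rule exE)
  have sub: "A i \<subseteq> X" if "i \<in> {1..M}" for i using A that by blast
  have ext: "\<not> A j \<subseteq> A i" if "i \<in> {1..M}" "j \<in> {1..M}" "i < j" for i j using A that by blast
  define B where "B i = (if i \<le> M then A i else insert x (A (i - M)))" for i
  have card: "2 ^ card (insert x X) = 2 * M"
    using insert.hyps by (simp add: M_def)
  have "B i \<subseteq> insert x X" if "i \<in> {1..2 * M}" for i
  proof (cases "i \<le> M")
    case True
    then show ?thesis using that sub[of i] by (auto simp: B_def)
  next
    case False
    then have "i - M \<in> {1..M}" using that by auto
    from sub[OF this] show ?thesis using False by (auto simp: B_def)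
  qed
  moreover have "\<not> B j \<subseteq> B i" if ij: "i \<in> {1..2 * M}" "j \<in> {1..2 * M}" "i < j" for i j
  proof -
    consider "j \<le> M" | "i \<le> M" "M < j" | "M < i" using ij by linarith
    then show ?thesis
    proof cases
      case 1
      then show ?thesis using ij ext[of i j] by (simp add: B_def)
    next
      case 2
      then show ?thesis using ij sub[of i] insert.hyps by (auto simp: B_def)
    next
      case 3
      then have m: "i - M \<in> {1..M}" "j - M \<in> {1..M}" "i - M < j - M" using ij by auto
      then have "x \<notin> A (j - M)" using sub insert.hyps by blast
      then show ?thesis using ext[OF m] 3 ij by (auto simp: B_def)
    qed
  qed
  ultimately show ?case unfolding card by blast
qed

lemma strict_increase_lower_bound:
  fixes f :: "nat \<Rightarrow> nat"
  assumes "\<And>i. 1 \<le> i \<Longrightarrow> i < m \<Longrightarrow> f i < f (Suc i)" "1 \<le> i" "i \<le> m"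
  shows "i \<le> Suc (f i)"
  using assms(2,3)
proof (induction i rule: dec_induct)
  case base
  then show ?case by simp
next
  case (step i)
  then show ?case using assms(1)[of i] by simp
qed

lemma antichain_not_arrows:
  fixes X :: "(nat \<Rightarrow> nat) set"
  assumes n: "n \<ge> 3" and fin: "finite X"
    and bound: "\<And>x r. x \<in> X \<Longrightarrow> r \<in> {1..q} \<Longrightarrow> x r < n - 2"
    and anti: "\<And>x y. x \<in> X \<Longrightarrow> y \<in> X \<Longrightarrow> x \<noteq> y \<Longrightarrow> \<exists>r \<in> {1..q}. x r < y r"
  shows "\<not> mono_path_arrows 3 q n (2 ^ card X)"
proof -
  define N :: nat where "N = 2 ^ card X"
  obtain A where A: "(\<forall>i \<in> {1..N}. A i \<subseteq> X) \<and>
      (\<forall>i \<in> {1..N}. \<forall>j \<in> {1..N}. i < j \<longrightarrow> \<not> A j \<subseteq> A i)"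
    using exists_subset_linear_extension[OF fin] unfolding N_def by (rule exE)
  have sub: "A i \<subseteq> X" if "i \<in> {1..N}" for i using A that by blast
  have ext: "\<not> A j \<subseteq> A i" if "i \<in> {1..N}" "j \<in> {1..N}" "i < j" for i j using A that by blast
  define v where "v i j = (SOME x. x \<in> A j - A i)" for i j
  have v: "v i j \<in> A j - A i" if "i \<in> {1..N}" "j \<in> {1..N}" "i < j" for i j
    unfolding v_def using ext[OF that] someI_ex[of "\<lambda>x. x \<in> A j - A i"] by blast
  define d where "d i j k = (SOME r. r \<in> {1..q} \<and> v i j r < v j k r)" for i j k
  have d: "d i j k \<in> {1..q} \<and> v i j (d i j k) < v j k (d i j k)"
    if "i \<in> {1..N}" "j \<in> {1..N}" "k \<in> {1..N}" "i < j" "j < k" for i j k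
  proof -
    have "v i j \<in> A j" "v j k \<in> A k" "v j k \<notin> A j" using v that by blast+
    then have "\<exists>r \<in> {1..q}. v i j r < v j k r"
      using anti sub that by (metis subsetD)
    then show ?thesis
      unfolding d_def using someI_ex[of "\<lambda>r. r \<in> {1..q} \<and> v i j r < v j k r"] by blast
  qed
  define c where "c e = d (Min e) (Min (e - {Min e})) (Max e)" for e
  have c: "c {i, j, k} = d i j k" if "i < j" "j < k" for i j k
  proof -
    have "Min {i, j, k} = i" "Max {i, j, k} = k" using that by auto
    moreover have "{i, j, k} - {i} = {j, k}" using that by auto
    moreover have "Min {j, k} = j" using that by auto
    ultimately show ?thesis by (simp only: c_def)
  qed
  have col: "c \<in> nsets {1..N} 3 \<rightarrow> {1..q}"
  proof
    fix e assume "e \<in> nsets {1..N} 3"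
    then obtain i j k where e: "e = {i, j, k}" "i \<in> {1..N}" "j \<in> {1..N}" "k \<in> {1..N}" "i < j" "j < k"
      unfolding ordered_nsets_3_eq by blast
    then show "c e \<in> {1..q}" using c d by metis
  qed
  have False if path: "monotone_path N n j" and mono: "\<forall>e \<in> path_edges 3 n j. c e = a" for j a
  proof -
    have inN: "j i \<in> {1..N}" if "i \<in> {1..n}" for i
      using path that unfolding monotone_path_def by blast
    have less: "j i < j (Suc i)" if "1 \<le> i" "i < n" for i
      using path that unfolding monotone_path_def by (auto intro: strict_mono_onD)
    have step: "a \<in> {1..q} \<and> v (j i) (j (Suc i)) a < v (j (Suc i)) (j (Suc (Suc i))) a"
      if i: "1 \<le> i" "i < n - 1" for i
    proof -
      have l: "j i < j (Suc i)" "j (Suc i) < j (Suc (Suc i))" using less i by auto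
      have "{j i, j (Suc i), j (Suc (Suc i))} \<in> path_edges 3 n j"
        unfolding path_edges_3 using i by auto
      then have "d (j i) (j (Suc i)) (j (Suc (Suc i))) = a" using mono c[OF l] by simp
      then show ?thesis using d[OF inN inN inN l] i by simp
    qed
    \<comment> \<open>The \<open>n\<close> vertices give \<open>n - 1\<close> consecutive pairs,
      along which coordinate \<open>a\<close> strictly increases from a value \<ge> 0. The last
      value is thus at least \<open>n - 2\<close>, against \<open>bound\<close>.\<close>
    have "n - 1 \<le> Suc (v (j (n - 1)) (j (Suc (n - 1))) a)"
      using strict_increase_lower_bound[of "n - 1" "\<lambda>i. v (j i) (j (Suc i)) a" "n - 1"] step n
      by simp
    moreover have "v (j (n - 1)) (j n) a < n - 2"
    proof (rule bound[of "v (j (n - 1)) (j n)" a])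
      \<comment> \<open>The common value \<open>a\<close> is not restricted a priori; as
        \<open>n \<ge> 3\<close>, the path has a first triple, and its colour lies in range.\<close>
      show "a \<in> {1..q}" using step[of 1] n by simp
      have "v (j (n - 1)) (j n) \<in> A (j n)"
        using v[of "j (n - 1)" "j n"] inN[of "n - 1"] inN[of n] less[of "n - 1"] n by simp
      then show "v (j (n - 1)) (j n) \<in> X" using sub inN[of n] n by auto
    qed
    ultimately show False using n by simp
  qed
  then show ?thesis using col unfolding mono_path_arrows_def N_def by blast
qed

text \<open>Choose \<open>p\<close> coordinates freely in \<open>{0..t}\<close> and let the last one
  balance the sum; vectors of equal sum are pairwise incomparable. The last coordinate can reach
  \<open>p * t\<close>, whence the hypothesis.\<close>

lemma exists_large_antichain:
  assumes p: "p * t < m"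
  shows "\<exists>X :: (nat \<Rightarrow> nat) set. finite X \<and> card X = (t + 1) ^ p \<and>
    (\<forall>x \<in> X. \<forall>r \<in> {1..Suc p}. x r < m) \<and>
    (\<forall>x \<in> X. \<forall>y \<in> X. x \<noteq> y \<longrightarrow> (\<exists>r \<in> {1..Suc p}. x r < y r))"
proof -
  define P where "P = PiE {1..p} (\<lambda>_. {0..t})"
  \<comment> \<open>All vectors \<open>g x\<close> have coordinate sum \<open>p * t\<close>.\<close>
  define g where "g x = x(Suc p := p * t - (\<Sum>r = 1..p. x r))" for x :: "nat \<Rightarrow> nat"
  have fin: "finite P" unfolding P_def by (intro finite_PiE) auto
  have card: "card P = (t + 1) ^ p" unfolding P_def by (simp add: card_PiE)
  have P: "x r \<le> t" if "x \<in> P" "r \<in> {1..p}" for x r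
    using that unfolding P_def by (auto simp: PiE_iff)
  \<comment> \<open>This makes the natural-number subtraction in \<open>g\<close> exact.\<close>
  have sum: "(\<Sum>r = 1..p. x r) \<le> p * t" if "x \<in> P" for x
    using sum_bounded_above[of "{1..p}" x t] P[OF that] by simp
  have key: "\<exists>r \<in> {1..Suc p}. g x r < g y r" if xy: "x \<in> P" "y \<in> P" "x \<noteq> y" for x y
  proof (rule ccontr)
    assume "\<not> ?thesis"
    then have le: "g y r \<le> g x r" if "r \<in> {1..Suc p}" for r using that by (meson not_less)
    have le1: "y r \<le> x r" if "r \<in> {1..p}" for r
      using le[of r] that by (auto simp: g_def)
    obtain s where s: "s \<in> {1..p}" "x s \<noteq> y s"
      using xy unfolding P_def by (meson PiE_ext)
    have "(\<Sum>r = 1..p. y r) < (\<Sum>r = 1..p. x r)"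
      using le1 s by (intro sum_strict_mono_ex1) (auto simp: nat_less_le intro!: bexI[of _ s])
    moreover have "p * t - (\<Sum>r = 1..p. y r) \<le> p * t - (\<Sum>r = 1..p. x r)"
      using le[of "Suc p"] by (simp add: g_def)
    ultimately show False using sum[OF xy(1)] by linarith
  qed
  have inj: "inj_on g P" using key by (metis inj_onI less_irrefl)
  have "g x r < m" if "x \<in> P" "r \<in> {1..Suc p}" for x r
  proof (cases "r = Suc p")
    case True
    then show ?thesis using p by (simp add: g_def)
  next
    case False
    then have "r \<in> {1..p}" using that by auto
    moreover from this have "t \<le> p * t" by (cases p) auto
    ultimately have "x r \<le> p * t" using P[OF that(1), of r] by linarith
    then show ?thesis using False p by (simp add: g_def)
  qed
  moreover have "\<exists>r \<in> {1..Suc p}. x r < y r" if "x \<in> g ` P" "y \<in> g ` P" "x \<noteq> y" for x y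
    using that key by blast
  ultimately show ?thesis
    using fin card card_image[OF inj] by (intro exI[of _ "g ` P"]) auto
qed

section \<open>Upper bound: longest monochromatic walks and down-sets\<close>

text \<open>
  \<open>tight_walk N c a l i j\<close>: some monotone path with \<open>l\<close> triples (hence \<open>l + 2\<close> vertices), all of
  colour \<open>a\<close>, ends in the vertices \<open>i < j\<close>.
\<close>

inductive tight_walk :: "nat \<Rightarrow> (nat set \<Rightarrow> nat) \<Rightarrow> nat \<Rightarrow> nat \<Rightarrow> nat \<Rightarrow> nat \<Rightarrow> bool"
  for N c a where
  start: "1 \<le> i \<Longrightarrow> i < j \<Longrightarrow> j \<le> N \<Longrightarrow> tight_walk N c a 0 i j"
| extend: "tight_walk N c a l i j \<Longrightarrow> j < k \<Longrightarrow> k \<le> N \<Longrightarrow> c {i, j, k} = a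
    \<Longrightarrow> tight_walk N c a (Suc l) j k"

text \<open>The guard \<open>l > 0\<close> is essential: for two vertices, truncated subtraction
  makes \<open>path_edges 3 2 g\<close> contain the spurious edge through
  \<open>g 3\<close>.\<close>

lemma tight_walk_path:
  assumes "tight_walk N c a l i j"
  shows "\<exists>g. monotone_path N (l + 2) g \<and> g (l + 1) = i \<and> g (l + 2) = j \<and>
    (\<forall>e \<in> path_edges 3 (l + 2) g. l > 0 \<longrightarrow> c e = a)"
  using assms
proof induction
  case (start i j)
  let ?g = "\<lambda>r. if r = (1::nat) then i else j"
  have "monotone_path N 2 ?g"
    unfolding monotone_path_def using start by (auto intro!: strict_mono_onI)
  then show ?case by (intro exI[of _ ?g]) (simp add: numeral_2_eq_2)
next
  case (extend l i j k)
  then obtain g where g: "monotone_path N (l + 2) g" "g (l + 1) = i" "g (l + 2) = j"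
    "\<forall>e \<in> path_edges 3 (l + 2) g. l > 0 \<longrightarrow> c e = a" by blast
  let ?g = "g(l + 3 := k)"
  have less: "g r < g s" if "r \<in> {1..l + 2}" "s \<in> {1..l + 2}" "r < s" for r s
    using g(1) that unfolding monotone_path_def by (meson strict_mono_onD)
  have le: "g r \<le> j" if "r \<in> {1..l + 2}" for r
    using less[of r "l + 2"] that g(3) by (cases "r = l + 2") auto
  have inN: "g r \<in> {1..N}" if "r \<in> {1..l + 2}" for r
    using g(1) that unfolding monotone_path_def by blast
  have "monotone_path N (Suc l + 2) ?g"
    unfolding monotone_path_def
  proof
    show "strict_mono_on {1..Suc l + 2} ?g"
    proof (rule strict_mono_onI)
      fix r s assume rs: "r \<in> {1..Suc l + 2}" "s \<in> {1..Suc l + 2}" "r < s"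
      show "?g r < ?g s"
      proof (cases "s = l + 3")
        case True
        then show ?thesis using rs le[of r] extend.hyps by auto
      next
        case False
        then show ?thesis using rs less[of r s] by auto
      qed
    qed
    have "?g r \<in> {1..N}" if "r \<in> {1..Suc l + 2}" for r
      using that inN[of r] extend.hyps by (cases "r = l + 3") auto
    then show "?g ` {1..Suc l + 2} \<subseteq> {1..N}" by blast
  qed
  moreover have "c e = a" if e: "e \<in> path_edges 3 (Suc l + 2) ?g" for e
  proof -
    obtain r where r: "e = {?g r, ?g (Suc r), ?g (Suc (Suc r))}" "1 \<le> r" "r \<le> Suc l"
      using e unfolding path_edges_3 by auto
    show ?thesis
    proof (cases "r = Suc l")
      case True
      then show ?thesis using r g(2,3) extend.hyps by (simp add: eval_nat_numeral)
    next
      case False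
      then have "e \<in> path_edges 3 (l + 2) g" using r unfolding path_edges_3 by auto
      then show ?thesis using g(4) False r by auto
    qed
  qed
  moreover have "?g (Suc l + 1) = j" "?g (Suc l + 2) = k" using g(3) by simp_all
  ultimately show ?case by blast
qed

text \<open>Dropping final triples leaves a walk. This cuts a walk that is too long down to exactly
  \<open>n\<close> vertices.\<close>

lemma tight_walk_shorten:
  assumes "tight_walk N c a l i j" "m \<le> l"
  shows "\<exists>i' j'. tight_walk N c a m i' j'"
  using assms
proof induction
  case (start i j)
  then show ?case using tight_walk.start[of i j N c a] by auto
next
  case (extend l i j k)
  then show ?case using tight_walk.extend by (metis le_Suc_eq)
qed

lemma mono_path_arrows_3_upper:
  assumes q: "q \<ge> 1" and n: "n \<ge> 3" and N: "(n - 1) ^ ((n - 2) ^ (q - 1)) < N"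
  shows "mono_path_arrows 3 q n N"
proof (rule ccontr)
  assume "\<not> ?thesis"
  then obtain c where c: "c \<in> nsets {1..N} 3 \<rightarrow> {1..q}"
    and no: "\<And>j a. monotone_path N n j \<Longrightarrow> \<forall>e \<in> path_edges 3 n j. c e = a \<Longrightarrow> False"
    unfolding mono_path_arrows_def by blast
  have short: "l < n - 2" if walk: "tight_walk N c a l i j" for a l i j
  proof (rule ccontr)
    assume "\<not> l < n - 2"
    then obtain i' j' where w: "tight_walk N c a (n - 2) i' j'"
      using tight_walk_shorten[OF walk, of "n - 2"] by auto
    have "n - 2 + 2 = n" "n - 2 > 0" using n by auto
    with tight_walk_path[OF w] show False using no by metis
  qed
  define L where "L a i j = Max {l. tight_walk N c a l i j}" for a i j
  have fin: "finite {l. tight_walk N c a l i j}" for a i j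
    by (rule finite_subset[of _ "{..<n - 2}"]) (auto intro: short)
  have L: "tight_walk N c a (L a i j) i j" if "1 \<le> i" "i < j" "j \<le> N" for a i j
    using Max_in[OF fin, of a i j] tight_walk.start[OF that, of c a] unfolding L_def by blast
  have Lless: "L a i j < n - 2" if "1 \<le> i" "i < j" "j \<le> N" for a i j
    using L[OF that] short by blast
  have step: "\<exists>a \<in> {1..q}. L a i j < L a j k" if "1 \<le> i" "i < j" "j < k" "k \<le> N" for i j k
  proof -
    have "{i, j, k} \<in> nsets {1..N} 3"
      using that by (auto simp: nsets_def)
    then have "c {i, j, k} \<in> {1..q}" using c by blast
    moreover have "tight_walk N c (c {i, j, k}) (Suc (L (c {i, j, k}) i j)) j k"
      using that by (intro tight_walk.extend[OF L]) auto
    then have "Suc (L (c {i, j, k}) i j) \<le> L (c {i, j, k}) j k"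
      unfolding L_def[of _ j k] using fin by (intro Max_ge) auto
    ultimately show ?thesis by (intro bexI[of _ "c {i, j, k}"]) auto
  qed
  define P where "P = PiE {1..q - 1} (\<lambda>_. {..<n - 2})"
  \<comment> \<open>\<open>h k x\<close> is the height over \<open>x\<close> of the down-set of \<open>k\<close>.\<close>
  define S where "S k x = {Suc (L q i k) | i. 1 \<le> i \<and> i < k \<and> (\<forall>a \<in> {1..q - 1}. x a \<le> L a i k)}"
    for k and x :: "nat \<Rightarrow> nat"
  \<comment> \<open>Inserting 0 gives an empty column height 0; the \<open>Suc\<close> in
    \<open>S\<close> keeps it apart from a column whose top entry is 0. So there are
    \<open>n - 1\<close> possible heights.\<close>
  define h where "h k = restrict (\<lambda>x. Max (insert 0 (S k x))) P" for k
  have S: "S k x \<subseteq> {..n - 2}" if "k \<le> N" for k x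
    unfolding S_def using Lless that by (auto simp: Suc_le_eq)
  have finS: "finite (S k x)" if "k \<le> N" for k x
    using S[OF that] by (rule finite_subset) simp
  have "Max (insert 0 (S k x)) \<le> n - 2" if "k \<le> N" for k x
    using S[OF that, of x] finS[OF that, of x] by (intro Max.boundedI) auto
  then have "h k \<in> PiE P (\<lambda>_. {..n - 2})" if "k \<in> {1..N}" for k
    using that unfolding h_def by (auto simp del: Max_insert)
  then have sub: "h ` {1..N} \<subseteq> PiE P (\<lambda>_. {..n - 2})" by blast
  have ne: "h j \<noteq> h k" if jk: "1 \<le> j" "j < k" "k \<le> N" for j k
  proof
    assume eq: "h j = h k"
    \<comment> \<open>The column in which the down-sets of \<open>j\<close> and \<open>k\<close>
      differ: the one of \<open>k\<close> contains the vector of \<open>(j, k)\<close>. If the one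
      of \<open>j\<close> were as high there, some \<open>(i, j)\<close> would dominate
      \<open>(j, k)\<close> in every colour, contradicting \<open>step\<close>.\<close>
    define x where "x = restrict (\<lambda>a. L a j k) {1..q - 1}"
    have "x \<in> P" unfolding P_def x_def using Lless[OF jk] by auto
    then have "Max (insert 0 (S j x)) = Max (insert 0 (S k x))"
      using fun_cong[OF eq, of x] by (simp add: h_def del: Max_insert)
    moreover have "Suc (L q j k) \<in> S k x"
      unfolding S_def x_def using jk by auto
    then have "Suc (L q j k) \<le> Max (insert 0 (S k x))"
      using finS[of k x] jk by (intro Max_ge) auto
    ultimately have ge: "Suc (L q j k) \<le> Max (insert 0 (S j x))" by simp
    moreover have "Max (insert 0 (S j x)) \<in> insert 0 (S j x)"
      using finS[of j x] jk by (intro Max_in) auto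
    ultimately obtain i where i: "1 \<le> i" "i < j" "\<forall>a \<in> {1..q - 1}. x a \<le> L a i j"
      "Max (insert 0 (S j x)) = Suc (L q i j)"
      unfolding S_def by auto
    have "L a j k \<le> L a i j" if "a \<in> {1..q}" for a
    proof (cases "a = q")
      case True
      then show ?thesis using ge i by simp
    next
      case False
      then have "a \<in> {1..q - 1}" using that by auto
      then show ?thesis using i(3) by (auto simp: x_def)
    qed
    then show False using step[OF i(1,2) jk(2,3)] by fastforce
  qed
  have "inj_on h {1..N}"
  proof (rule inj_onI)
    fix j k assume "j \<in> {1..N}" "k \<in> {1..N}" "h j = h k"
    then show "j = k" using ne[of j k] ne[of k j] by (cases j k rule: linorder_cases) auto
  qed
  moreover have finP: "finite P" unfolding P_def by (intro finite_PiE) auto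
  ultimately have "card {1..N} \<le> card (PiE P (\<lambda>_. {..n - 2}))"
    using sub by (intro card_inj_on_le) (auto intro: finite_PiE)
  also have "\<dots> = (n - 1) ^ ((n - 2) ^ (q - 1))"
  proof -
    have "card P = (n - 2) ^ (q - 1)" unfolding P_def by (simp add: card_PiE)
    moreover have "Suc (n - 2) = n - 1" using n by simp
    ultimately show ?thesis using finP by (simp add: card_PiE)
  qed
  finally show False using N by simp
qed

section \<open>Numerical estimates and the two bounds\<close>

text \<open>Division with remainder gives \<open>n \<le> p * t + p + 2\<close>, while
  \<open>q * (t + 1) = p * t + p + t + 1\<close>. The gap is closed by \<open>t \<ge> 1\<close>,
  which is what \<open>n \<ge> q + 2\<close> ensures.\<close>

lemma antichain_side_lower_bound:
  fixes q n :: nat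
  assumes "q \<ge> 2" "n \<ge> q + 2"
  shows "n \<le> q * ((n - 3) div (q - 1) + 1)"
proof -
  define p where "p = q - 1"
  define t where "t = (n - 3) div p"
  have p: "q = p + 1" "p \<ge> 1" "n - 3 \<ge> p" using assms by (auto simp: p_def)
  have "t \<ge> 1" unfolding t_def using p by (simp add: Suc_le_eq div_greater_zero_iff)
  have "n - 3 = p * t + (n - 3) mod p" by (simp add: t_def)
  moreover have "(n - 3) mod p < p" using p by simp
  ultimately have "n - 3 < p * t + p" by linarith
  then have "n \<le> p * t + p + 2" by linarith
  also have "\<dots> \<le> q * (t + 1)" using p \<open>t \<ge> 1\<close> by (simp add: algebra_simps)
  finally show ?thesis by (simp add: t_def p_def)
qed

theorem theorem2:
  fixes q n :: nat
  assumes "q \<ge> 2" and "n \<ge> q + 2"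
  shows "2 powr ((real n / real q) ^ (q - 1)) \<le> real (path_ramsey 3 q n)
       \<and> real (path_ramsey 3 q n) \<le> 2 powr (real n ^ (q - 1) * log 2 (real n))"
proof
  define U where "U = n ^ (n ^ (q - 1))"
  have "(n - 1) ^ ((n - 2) ^ (q - 1)) \<le> (n - 1) ^ (n ^ (q - 1))"
    using assms by (intro power_increasing power_mono) auto
  also have "\<dots> < U"
    unfolding U_def using assms by (intro power_strict_mono) auto
  finally have U: "mono_path_arrows 3 q n U"
    using assms by (intro mono_path_arrows_3_upper) auto
  have "real (path_ramsey 3 q n) \<le> real U"
    unfolding path_ramsey_def using Least_le[of "mono_path_arrows 3 q n", OF U] by simp
  also have "real U = 2 powr (real n ^ (q - 1) * log 2 (real n))"
  proof -
    have "2 powr (real n ^ (q - 1) * log 2 (real n)) = (2 powr log 2 (real n)) powr real (n ^ (q - 1))"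
      by (simp add: powr_powr mult.commute)
    also have "\<dots> = real n powr real (n ^ (q - 1))" using assms by simp
    also have "\<dots> = real n ^ (n ^ (q - 1))" using assms by (intro powr_realpow) simp
    finally show ?thesis by (simp add: U_def)
  qed
  finally show "real (path_ramsey 3 q n) \<le> 2 powr (real n ^ (q - 1) * log 2 (real n))" .

  \<comment> \<open>The largest \<open>t\<close> with \<open>(q - 1) * t < n - 2\<close>, as the
    antichain in \<open>{0..<n - 2}^q\<close> demands.\<close>
  define t where "t = (n - 3) div (q - 1)"
  have "(q - 1) * t \<le> n - 3" by (simp add: t_def)
  then have "(q - 1) * t < n - 2" using assms by linarith
  from exists_large_antichain[OF this] obtain X :: "(nat \<Rightarrow> nat) set" where
    X: "finite X" "card X = (t + 1) ^ (q - 1)" "\<forall>x \<in> X. \<forall>r \<in> {1..q}. x r < n - 2"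
      "\<forall>x \<in> X. \<forall>y \<in> X. x \<noteq> y \<longrightarrow> (\<exists>r \<in> {1..q}. x r < y r)"
    using assms by auto
  have "\<not> mono_path_arrows 3 q n (2 ^ card X)"
    using X assms by (intro antichain_not_arrows) auto
  \<comment> \<open>The lower bound also relies on \<open>U\<close>: it shows that the minimum
    defining \<open>path_ramsey\<close> is attained.\<close>
  moreover have "mono_path_arrows 3 q n (path_ramsey 3 q n)"
    unfolding path_ramsey_def using U by (rule LeastI)
  ultimately have less: "2 ^ ((t + 1) ^ (q - 1)) < path_ramsey 3 q n"
    using mono_path_arrows_mono X(2) by (metis not_less)
  have "real n / real q \<le> real (t + 1)"
  proof -
    have "real n \<le> real (q * (t + 1))"
      using antichain_side_lower_bound[OF assms] unfolding t_def by (intro of_nat_mono)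
    then show ?thesis using assms by (simp add: field_simps)
  qed
  then have "(real n / real q) ^ (q - 1) \<le> real ((t + 1) ^ (q - 1))"
    unfolding of_nat_power by (intro power_mono) auto
  then have "2 powr ((real n / real q) ^ (q - 1)) \<le> 2 powr real ((t + 1) ^ (q - 1))"
    by (intro powr_mono) auto
  also have "\<dots> = real (2 ^ ((t + 1) ^ (q - 1)))" by (subst powr_realpow) auto
  also have "\<dots> \<le> real (path_ramsey 3 q n)" using less by (intro of_nat_mono) simp
  finally show "2 powr ((real n / real q) ^ (q - 1)) \<le> real (path_ramsey 3 q n)" .
qed

end
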